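(* Let $\lambda$ be a partition with $\ell(\lambda)$ nonzero parts, and set $\lambda_0:=0$. Then $$Q_{\lambda}=\begin{cases}-\displaystyle\sum_{k=1}^{\ell(\lambda)}(-1)^k a_k^\lambda\, Q_{\lambda/(\lambda_k)}&\text{if }\ell(\lambda)\text{ is odd},\\[2mm] \displaystyle\sum_{k=0}^{\ell(\lambda)}(-1)^k a_k^\lambda\, Q_{\lambda/(\lambda_k)}&\text{if }\ell(\lambda)\text{ is even},\end{cases}$$ where $a_0^\lambda:=1$ and, for $1\le k\le\ell(\lambda)$, $a_k^\lambda:=-\sum_{i=k}^{\ell(\lambda)}(-1)^iq_{\lambda_i}r_{k,i}^\lambda$.
   Context: Let $x_1,x_2,\ldots$ be variables and define symmetric functions $q_n$ ($n\in\mathbb{Z}$) by $\prod_{i\ge1}\frac{1+zx_i}{1-zx_i}=\sum_{n\in\mathbb{Z}}q_nz^n$; so $q_0=1$ and $q_n=0$ for $n<0$. For $r,s\in\mathbb{Z}$ put $Q_{(r,s)}:=q_rq_s+2\sum_{i=1}^s(-1)^iq_{r+i}q_{s-i}$ (the sum is empty if $s<1$). A composition is a finite sequence of integers; a partition is a weakly decreasing composition with nonnegative parts. For a composition $\nu=(\nu_1,\ldots,\nu_N)$ let $M(\nu)$ be the $N\times N$ skew-symmetric matrix with $ij$-entry $Q_{(\nu_i,\nu_j)}$ if $i<j$, $0$ if $i=j$, and $-Q_{(\nu_j,\nu_i)}$ if $i>j$. For $\lambda\in\mathbb{Z}^n$ put $\lambda0:=(\lambda_1,\ldots,\lambda_n,0)$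 and define $Q_\lambda:=\operatorname{Pf}M(\lambda)$ if $n$ is even and $Q_\lambda:=\operatorname{Pf}M(\lambda0)$ if $n$ is odd. Here $\operatorname{Pf}$ is the Pfaffian, normalized by $\operatorname{Pf}M=\sum_{j=2}^{2N}(-1)^jm_{1j}\operatorname{Pf}M_{1j}$, where $M_{1j}$ is $M$ with rows and columns $1,j$ deleted; the empty Pfaffian is $1$. For $\lambda\in\mathbb{Z}^n$, $\mu\in\mathbb{Z}^m$, let $N(\lambda,\mu)$ be the $n\times m$ matrix with $(i,j)$ entry $q_{\lambda_i-\mu_{m+1-j}}$, and $M(\lambda,\mu):=\begin{pmatrix}M(\lambda)&N(\lambda,\mu)\\-N(\lambda,\mu)^t&0\end{pmatrix}$. The skew function is $Q_{\lambda/\mu}:=\operatorname{Pf}M(\lambda,\mu)$ if $n+m$ is even and $\operatorname{Pf}M(\lambda0,\mu)$ if $n+m$ is odd. In $Q_{\lambda/(\lambda_k)}$, $(\lambda_k)$ is the one-part composition. For a partition $\lambda$ and indices $i\le k$, the coefficients $r_{i,k}^\lambda$ are defined recursively by $r_{i,i}^\lambda:=1$ and, for $k>i$, $r_{i,k}^\lambda:=-\sum_{j=i}^{k-1}(-1)^{j-k}q_{\lambda_j-\lambda_k}r_{i,j}^\lambda$. *)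

theory Defs
  imports
    Complex_Main
    "HOL-Library.Multiset"
    "HOL-Computational_Algebra.Formal_Power_Series"
    "Jordan_Normal_Form.Determinant"
begin

section \<open>Formal power series in infinitely many variables\<close>

text \<open>
  Symmetric functions in infinitely many variables are formal power series. A monomial in the
  variables is a finite multiset of variable indices, and a series is the function giving the
  coefficient of each monomial. The variables are indexed from 0, so the variable usually
  written \<open>x\<^sub>1\<close> is \<open>mX 0\<close>.
\<close>

typedef 'a mps = "UNIV :: (nat multiset \<Rightarrow> 'a) set"
  morphisms mcoeff Abs_mps ..

setup_lifting type_definition_mps

lemma mps_eqI: "(\<And>M. mcoeff f M = mcoeff g M) \<Longrightarrow> f = g"
  by (metis ext mcoeff_inject)

lemma finite_submultisets: "finite {A. A \<subseteq># M}"
proof (induction M)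
  case (add x M)
  have "{A. A \<subseteq># add_mset x M} \<subseteq> {A. A \<subseteq># M} \<union> add_mset x ` {A. A \<subseteq># M}"
  proof
    fix A assume A: "A \<in> {A. A \<subseteq># add_mset x M}"
    show "A \<in> {A. A \<subseteq># M} \<union> add_mset x ` {A. A \<subseteq># M}"
    proof (cases "x \<in># A")
      case True
      then obtain B where "A = add_mset x B" by (metis insert_DiffM)
      with A show ?thesis by auto
    next
      case False
      with A have "A \<subseteq># M"
        by (simp add: subseteq_mset_def not_in_iff) (metis le0)
      then show ?thesis by simp
    qed
  qed
  with add show ?case by (meson finite_UnI finite_imageI finite_subset)
qed simp

lemma sub_diff: "A \<subseteq># M \<Longrightarrow> A - B \<subseteq># M - (B :: 'b multiset)"
  by (simp add: subseteq_mset_def diff_le_mono)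

lemma diff_sub: "A \<subseteq># M \<Longrightarrow> M - (M - A) = (A :: 'b multiset)"
  by (simp add: multiset_eq_iff subseteq_mset_def)

instantiation mps :: (comm_ring_1) comm_ring_1
begin

lift_definition zero_mps :: "'a mps" is "\<lambda>_. 0" .
lift_definition one_mps :: "'a mps" is "\<lambda>M. if M = {#} then 1 else 0" .
lift_definition plus_mps :: "'a mps \<Rightarrow> 'a mps \<Rightarrow> 'a mps" is "\<lambda>f g M. f M + g M" .
lift_definition minus_mps :: "'a mps \<Rightarrow> 'a mps \<Rightarrow> 'a mps" is "\<lambda>f g M. f M - g M" .
lift_definition uminus_mps :: "'a mps \<Rightarrow> 'a mps" is "\<lambda>f M. - f M" .
lift_definition times_mps :: "'a mps \<Rightarrow> 'a mps \<Rightarrow> 'a mps"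
  is "\<lambda>f g M. \<Sum>A | A \<subseteq># M. f A * g (M - A)" .

instance
proof
  fix f g h :: "'a mps"
  show "f * g * h = f * (g * h)"
  proof (rule mps_eqI)
    fix M
    have "mcoeff (f * g * h) M
        = (\<Sum>A | A \<subseteq># M. \<Sum>B | B \<subseteq># A. mcoeff f B * mcoeff g (A - B) * mcoeff h (M - A))"
      by (simp add: times_mps.rep_eq sum_distrib_right)
    also have "\<dots> = (\<Sum>(A, B) \<in> (SIGMA A:{A. A \<subseteq># M}. {B. B \<subseteq># A}).
        mcoeff f B * mcoeff g (A - B) * mcoeff h (M - A))"
      by (simp add: sum.Sigma finite_submultisets)
    also have "\<dots> = (\<Sum>(B, C) \<in> (SIGMA B:{B. B \<subseteq># M}. {C. C \<subseteq># M - B}).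
        mcoeff f B * (mcoeff g C * mcoeff h (M - B - C)))"
      by (rule sum.reindex_bij_witness[where i = "\<lambda>(B, C). (B + C, B)" and j = "\<lambda>(A, B). (B, A - B)"])
        (auto simp: mult.assoc subset_mset.le_diff_conv2 add.commute
          intro: subset_mset.order_trans sub_diff)
    also have "\<dots> = mcoeff (f * (g * h)) M"
      by (simp add: times_mps.rep_eq sum_distrib_left sum.Sigma finite_submultisets)
    finally show "mcoeff (f * g * h) M = mcoeff (f * (g * h)) M" .
  qed
  show "f * g = g * f"
  proof (rule mps_eqI)
    fix M
    show "mcoeff (f * g) M = mcoeff (g * f) M"
      unfolding times_mps.rep_eq
      by (rule sum.reindex_bij_witness[where i = "\<lambda>A. M - A" and j = "\<lambda>A. M - A"])
        (auto simp: diff_sub mult.commute)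
  qed
  show "1 * f = f"
  proof (rule mps_eqI)
    fix M
    have "mcoeff (1 * f) M = (\<Sum>A | A \<subseteq># M. if A = {#} then mcoeff f M else 0)"
      unfolding times_mps.rep_eq one_mps.rep_eq by (intro sum.cong) auto
    then show "mcoeff (1 * f) M = mcoeff f M"
      by (simp add: finite_submultisets)
  qed
  show "(f + g) * h = f * h + g * h"
    by (rule mps_eqI) (simp add: times_mps.rep_eq plus_mps.rep_eq distrib_right sum.distrib)
  show "(0::'a mps) \<noteq> 1"
    by (metis one_mps.rep_eq zero_mps.rep_eq zero_neq_one)
qed (transfer; simp add: algebra_simps fun_eq_iff)+

end

lift_definition mX :: "nat \<Rightarrow> 'a::comm_ring_1 mps"
  is "\<lambda>i M. if M = {#i#} then 1 else 0" .

text \<open>Coefficientwise convergence: each coefficient is eventually constant.\<close>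

instantiation mps :: (type) t2_space
begin

definition open_mps :: "'a mps set \<Rightarrow> bool" where
  "open_mps U \<longleftrightarrow>
     (\<forall>f\<in>U. \<exists>S. finite S \<and> (\<forall>g. (\<forall>M\<in>S. mcoeff g M = mcoeff f M) \<longrightarrow> g \<in> U))"

instance
proof
  show "open (UNIV :: 'a mps set)"
    unfolding open_mps_def by auto
  show "open (U \<inter> V)" if U: "open U" and V: "open V" for U V :: "'a mps set"
    unfolding open_mps_def
  proof
    fix f assume f: "f \<in> U \<inter> V"
    obtain S where S: "finite S" "\<And>g. (\<forall>M\<in>S. mcoeff g M = mcoeff f M) \<Longrightarrow> g \<in> U"
      using U f unfolding open_mps_def by (meson IntD1)
    obtain T where T: "finite T" "\<And>g. (\<forall>M\<in>T. mcoeff g M = mcoeff f M) \<Longrightarrow> g \<in> V"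
      using V f unfolding open_mps_def by (meson IntD2)
    show "\<exists>S. finite S \<and> (\<forall>g. (\<forall>M\<in>S. mcoeff g M = mcoeff f M) \<longrightarrow> g \<in> U \<inter> V)"
      by (rule exI[of _ "S \<union> T"]) (auto simp: S T)
  qed
  show "open (\<Union>K)" if K: "\<forall>U\<in>K. open U" for K :: "'a mps set set"
    unfolding open_mps_def
  proof
    fix f assume "f \<in> \<Union>K"
    then obtain U where U: "U \<in> K" "f \<in> U" by blast
    with K obtain S where "finite S" "\<forall>g. (\<forall>M\<in>S. mcoeff g M = mcoeff f M) \<longrightarrow> g \<in> U"
      unfolding open_mps_def by meson
    with U show "\<exists>S. finite S \<and> (\<forall>g. (\<forall>M\<in>S. mcoeff g M = mcoeff f M) \<longrightarrow> g \<in> \<Union>K)"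
      by blast
  qed
  show "\<exists>U V. open U \<and> open V \<and> f \<in> U \<and> g \<in> V \<and> U \<inter> V = {}" if "f \<noteq> g" for f g :: "'a mps"
  proof -
    have "\<not> (\<forall>M. mcoeff f M = mcoeff g M)"
    proof
      assume "\<forall>M. mcoeff f M = mcoeff g M"
      then have "f = g" by (intro mps_eqI) simp
      with that show False by simp
    qed
    then obtain M where M: "mcoeff f M \<noteq> mcoeff g M" by (auto simp only: not_all)
    have "open {h :: 'a mps. mcoeff h M = c}" for c
      unfolding open_mps_def by (auto intro!: exI[of _ "{M}"])
    with M show ?thesis
      by (intro exI[of _ "{h. mcoeff h M = mcoeff f M}"] exI[of _ "{h. mcoeff h M = mcoeff g M}"])
        auto
  qed
qed

end

lemma tendsto_mps_iff:
  "(X \<longlongrightarrow> f) F \<longleftrightarrow> (\<forall>M. \<forall>\<^sub>F N in F. mcoeff (X N) M = mcoeff f M)"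
proof
  assume X: "(X \<longlongrightarrow> f) F"
  show "\<forall>M. \<forall>\<^sub>F N in F. mcoeff (X N) M = mcoeff f M"
  proof
    fix M
    have "open {h. mcoeff h M = mcoeff f M}"
      unfolding open_mps_def by (auto intro!: exI[of _ "{M}"])
    from topological_tendstoD[OF X this] show "\<forall>\<^sub>F N in F. mcoeff (X N) M = mcoeff f M"
      by simp
  qed
next
  assume X: "\<forall>M. \<forall>\<^sub>F N in F. mcoeff (X N) M = mcoeff f M"
  show "(X \<longlongrightarrow> f) F"
  proof (rule topological_tendstoI)
    fix U assume "open U" "f \<in> U"
    then obtain S where S: "finite S" "\<And>g. (\<forall>M\<in>S. mcoeff g M = mcoeff f M) \<Longrightarrow> g \<in> U"
      unfolding open_mps_def by meson
    have "\<forall>\<^sub>F N in F. \<forall>M\<in>S. mcoeff (X N) M = mcoeff f M"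
      using X S(1) by (simp add: eventually_ball_finite)
    then show "\<forall>\<^sub>F N in F. X N \<in> U"
      by (rule eventually_mono) (rule S(2))
  qed
qed


section \<open>The symmetric functions \<open>q\<^sub>n\<close>\<close>

text \<open>
  \<open>(1 + z x\<^sub>i) / (1 - z x\<^sub>i)\<close> as a power series in \<open>z\<close>; the library's division
  of power series needs an inverse on the coefficients, so
  \<open>1 / (1 - z x\<^sub>i)\<close> is written as the geometric series.
\<close>

definition q_factor :: "nat \<Rightarrow> 'a::comm_ring_1 mps fps" where
  "q_factor i = (1 + fps_const (mX i) * fps_X) * Abs_fps (\<lambda>n. mX i ^ n)"

lemma geometric_fps:
  "Abs_fps (\<lambda>n. c ^ n) * (1 - fps_const c * fps_X) = (1 :: 'b::comm_ring_1 fps)"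
proof -
  define F where "F = Abs_fps (\<lambda>n. c ^ n)"
  have "F * (1 - fps_const c * fps_X) = F - fps_const c * (fps_X * F)"
    by (subst right_diff_distrib, subst mult.commute[of F "_ * _"]) (simp only: mult.assoc mult_1_right)
  also have "\<dots> = 1"
  proof (rule fps_ext)
    fix n
    show "fps_nth (F - fps_const c * (fps_X * F)) n = fps_nth 1 n"
      by (cases n) (simp_all add: F_def)
  qed
  finally show ?thesis unfolding F_def .
qed

lemma q_factor_times_denominator:
  "q_factor i * (1 - fps_const (mX i) * fps_X) = 1 + fps_const (mX i) * fps_X"
  unfolding q_factor_def mult.assoc geometric_fps by (rule mult_1_right)

definition q :: "int \<Rightarrow> 'a::comm_ring_1 mps" where
  "q n = (if n < 0 then 0 else lim (\<lambda>N. fps_nth (\<Prod>i<N. q_factor i) (nat n)))"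

text \<open>The limit exists, i.e. the infinite product makes sense; see \<open>tendsto_q\<close> below.\<close>

lemma geometric_fps_nth:
  "fps_nth ((1 + fps_const c * fps_X) * Abs_fps (\<lambda>n. c ^ n)) n
     = (if n = 0 then 1 else 2 * c ^ n)" for c :: "'b::comm_ring_1"
proof -
  have "(1 + fps_const c * fps_X) * Abs_fps (\<lambda>n. c ^ n)
      = Abs_fps (\<lambda>n. c ^ n) + fps_const c * (fps_X * Abs_fps (\<lambda>n. c ^ n))"
    by (simp only: distrib_right mult_1_left mult.assoc)
  then show ?thesis by (cases n) simp_all
qed

lemma q_factor_nth: "fps_nth (q_factor i) n = (if n = 0 then 1 else 2 * mX i ^ n)"
  unfolding q_factor_def by (rule geometric_fps_nth)

lemma mcoeff_mX_mult_eq_0: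
  assumes "i \<notin># M" shows "mcoeff (mX i * g) M = 0"
  unfolding times_mps.rep_eq
proof (rule sum.neutral, rule ballI)
  fix A assume "A \<in> {A. A \<subseteq># M}"
  with assms have "A \<noteq> {#i#}" by auto
  then show "mcoeff (mX i) A * mcoeff g (M - A) = 0" by (simp add: mX.rep_eq)
qed

lemma mcoeff_mult_q_factor:
  assumes "i \<notin># M"
  shows "mcoeff (fps_nth (P * q_factor i) n) M = mcoeff (fps_nth P n) M"
proof -
  have mcoeff_sum: "mcoeff (sum h S) M = (\<Sum>k\<in>S. mcoeff (h k) M)" for h :: "nat \<Rightarrow> 'a mps" and S
    by (induction S rule: infinite_finite_induct) (simp_all add: zero_mps.rep_eq plus_mps.rep_eq)
  have "mcoeff (fps_nth P k * fps_nth (q_factor i) (n - k)) M = 0" if kn: "k < n" for k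
  proof -
    obtain l where l: "n - k = Suc l" using kn by (cases "n - k") auto
    have "fps_nth P k * fps_nth (q_factor i) (n - k) = mX i * (2 * fps_nth P k * mX i ^ l)"
      unfolding l q_factor_nth by (simp add: mult_ac)
    then show ?thesis using assms by (simp add: mcoeff_mX_mult_eq_0)
  qed
  then have "mcoeff (fps_nth (P * q_factor i) n) M
      = (\<Sum>k=0..n. if k = n then mcoeff (fps_nth P n) M else 0)"
    unfolding fps_mult_nth mcoeff_sum by (intro sum.cong) (auto simp: q_factor_nth simp del: power_Suc)
  then show ?thesis by simp
qed

lemma tendsto_q:
  assumes "0 \<le> n"
  shows "(\<lambda>N. fps_nth (\<Prod>i<N. q_factor i) (nat n)) \<longlonglongrightarrow> (q n :: 'a::comm_ring_1 mps)"
proof -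
  define X :: "nat \<Rightarrow> 'a mps" where "X = (\<lambda>N. fps_nth (\<Prod>i<N. q_factor i) (nat n))"
  define B where "B = (\<lambda>M :: nat multiset. SOME b. \<forall>i. i \<in># M \<longrightarrow> i < b)"
  have B: "i < B M" if "i \<in># M" for i M
  proof -
    have "\<exists>b. \<forall>i. i \<in># M \<longrightarrow> i < b"
      using finite_nat_set_iff_bounded[of "set_mset M"] by auto
    from someI_ex[OF this] show ?thesis using that unfolding B_def by blast
  qed
  have stable: "mcoeff (X N) M = mcoeff (X (B M)) M" if "B M \<le> N" for N M
    using that
  proof (induction N rule: dec_induct)
    case (step N)
    then have "N \<notin># M" using B by (meson leD)
    then have "mcoeff (X (Suc N)) M = mcoeff (X N) M"
      unfolding X_def by (simp add: mcoeff_mult_q_factor)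
    with step show ?case by simp
  qed simp
  have "X \<longlonglongrightarrow> Abs_mps (\<lambda>M. mcoeff (X (B M)) M)"
    unfolding tendsto_mps_iff
  proof
    fix M
    show "\<forall>\<^sub>F N in sequentially. mcoeff (X N) M = mcoeff (Abs_mps (\<lambda>M. mcoeff (X (B M)) M)) M"
      using eventually_ge_at_top[of "B M"]
      by (rule eventually_mono) (subst Abs_mps_inverse, simp, erule stable)
  qed
  then have "X \<longlonglongrightarrow> lim X"
    by (simp add: limI)
  then show ?thesis
    using assms by (simp add: q_def X_def)
qed

definition Q2 :: "int \<Rightarrow> int \<Rightarrow> 'a::comm_ring_1 mps" where
  "Q2 r s = q r * q s + 2 * (\<Sum>i=1..s. (-1) ^ nat i * q (r + i) * q (s - i))"


section \<open>Pfaffians and Q-functions\<close>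

lemma dim_mat_delete_aux:
  "dim_row (mat_delete (mat_delete A j j) 0 0) = dim_row A - 2"
  by (simp add: mat_delete_def)

text \<open>
  Expansion along the first row. Indices start at 0, so \<open>j\<close> stands for the column \<open>j + 1\<close> in
  the usual numbering; since \<open>j > 0\<close>, deleting \<open>j\<close> first leaves index 0 in place. Only
  skew-symmetric matrices of even size are of interest.
\<close>

function pfaffian :: "'a::comm_ring_1 mat \<Rightarrow> 'a" where
  "pfaffian A = (if dim_row A = 0 then 1
     else \<Sum>j\<in>{1..<dim_row A}.
       (-1) ^ (j + 1) * A $$ (0, j) * pfaffian (mat_delete (mat_delete A j j) 0 0))"
  by pat_completeness auto
termination
  by (relation "measure dim_row") (auto simp: dim_mat_delete_aux)

declare pfaffian.simps [simp del]

definition M_mat :: "int list \<Rightarrow> 'a::comm_ring_1 mps mat" where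
  "M_mat nu = mat (length nu) (length nu) (\<lambda>(i, j).
     if i < j then Q2 (nu ! i) (nu ! j) else if i = j then 0 else - Q2 (nu ! j) (nu ! i))"

definition Q :: "int list \<Rightarrow> 'a::comm_ring_1 mps" where
  "Q lam = (if even (length lam) then pfaffian (M_mat lam) else pfaffian (M_mat (lam @ [0])))"

definition N_mat :: "int list \<Rightarrow> int list \<Rightarrow> 'a::comm_ring_1 mps mat" where
  "N_mat lam mu = mat (length lam) (length mu) (\<lambda>(i, j). q (lam ! i - mu ! (length mu - 1 - j)))"

definition M_skew_mat :: "int list \<Rightarrow> int list \<Rightarrow> 'a::comm_ring_1 mps mat" where
  "M_skew_mat lam mu = four_block_mat (M_mat lam) (N_mat lam mu)
     (- transpose_mat (N_mat lam mu)) (0\<^sub>m (length mu) (length mu))"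

definition Q_skew :: "int list \<Rightarrow> int list \<Rightarrow> 'a::comm_ring_1 mps" where
  "Q_skew lam mu = (if even (length lam + length mu) then pfaffian (M_skew_mat lam mu)
     else pfaffian (M_skew_mat (lam @ [0]) mu))"


section \<open>Partitions and the coefficients\<close>

text \<open>Trailing zeros are allowed in a partition, and \<open>num_parts\<close> does not count them.\<close>

definition is_partition :: "int list \<Rightarrow> bool" where
  "is_partition lam \<longleftrightarrow> sorted_wrt (\<ge>) lam \<and> (\<forall>x\<in>set lam. 0 \<le> x)"

definition num_parts :: "int list \<Rightarrow> nat" where
  "num_parts lam = length (filter (\<lambda>x. x \<noteq> 0) lam)"

text \<open>Parts are numbered from 1; the value at 0 is the convention \<open>\<lambda>\<^sub>0 = 0\<close>.\<close>

definition part :: "int list \<Rightarrow> nat \<Rightarrow> int" where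
  "part lam k = (if k = 0 then 0 else lam ! (k - 1))"

text \<open>
  Meaningful for \<open>1 \<le> i \<le> k \<le> length lam\<close>. The sign \<open>(-1) ^ (k - j)\<close> equals \<open>(-1)\<close> to the
  negative power \<open>j - k\<close>.
\<close>

function r_coeff :: "int list \<Rightarrow> nat \<Rightarrow> nat \<Rightarrow> 'a::comm_ring_1 mps" where
  "r_coeff lam i k = (if i = k then 1
     else - (\<Sum>j\<in>{i..<k}. (-1) ^ (k - j) * q (part lam j - part lam k) * r_coeff lam i j))"
  by pat_completeness auto
termination
  by (relation "measure (\<lambda>(_, _, k). k)") auto

declare r_coeff.simps [simp del]

definition a_coeff :: "int list \<Rightarrow> nat \<Rightarrow> 'a::comm_ring_1 mps" where
  "a_coeff lam k = (if k = 0 then 1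
     else - (\<Sum>i=k..num_parts lam. (-1) ^ i * q (part lam i) * r_coeff lam k i))"

end

theory Submission
  imports Defs
begin

text \<open>
  Expanding a Pfaffian along its last column shows that \<open>Q_skew lam [\<mu>]\<close> is linear in the
  column with entries \<open>q (\<lambda>\<^sub>i - \<mu>)\<close>. The coefficients \<open>r_coeff\<close> are, up to signs, the
  entries of the inverse of the unitriangular matrix \<open>q (\<lambda>\<^sub>i - \<lambda>\<^sub>k)\<close> with \<open>i \<le> k\<close>, so the
  combination of these columns with coefficients \<open>(-1)\<^sup>k a\<^sub>k\<close>, \<open>k \<ge> 1\<close>, is the column
  \<open>- q \<lambda>\<^sub>i\<close> on the nonzero parts. For an odd number of parts this is, up to sign, the
  column of \<open>\<lambda>0\<close> that belongs to the part 0. For an even number of parts the term \<open>k = 0\<close>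
  cancels it and leaves only the row of the part 0, whose minor is \<open>Q lam\<close>.
\<close>

section \<open>Pfaffians indexed by lists\<close>

text \<open>A minor of a matrix with entries \<open>f (xs ! i) (xs ! j)\<close> becomes a shorter
  list, so iterated minors need no matrix reindexing.\<close>

definition del :: "nat \<Rightarrow> 'b list \<Rightarrow> 'b list" where
  "del j xs = take j xs @ drop (Suc j) xs"

lemma length_del: "j < length xs \<Longrightarrow> length (del j xs) = length xs - 1"
  by (simp add: del_def)

lemma nth_del:
  "j < length xs \<Longrightarrow> i < length xs - 1 \<Longrightarrow> del j xs ! i = xs ! insert_index j i"
  by (auto simp: del_def nth_append insert_index_def)

lemma del_append: "j < length xs \<Longrightarrow> del j (xs @ ys) = del j xs @ ys"
  by (simp add: del_def)

lemma del_append_right: "del (length xs + j) (xs @ ys) = xs @ del j ys"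
  by (simp add: del_def)

lemma del_length_snoc: "del (length xs) (xs @ [y]) = xs"
  by (simp add: del_def)

lemma del_Suc_Cons: "del (Suc j) (x # xs) = x # del j xs"
  by (simp add: del_def)

lemma del_map: "del j (map g xs) = map g (del j xs)"
  by (simp add: del_def take_map drop_map)

lemma del_replicate: "j < n \<Longrightarrow> del j (replicate n x) = replicate (n - 1) x"
  by (simp add: del_def replicate_add[symmetric])

text \<open>Once the entry \<open>a\<close> is gone, later positions drop by one; this shift
  produces the signs in the double expansions below.\<close>

lemma del_del:
  assumes "a < b" "b < length xs"
  shows "del a (del b xs) = del (b - 1) (del a xs)"
proof (rule nth_equalityI)
  show "length (del a (del b xs)) = length (del (b - 1) (del a xs))"
    using assms by (simp add: length_del)
next
  fix i assume "i < length (del a (del b xs))"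
  then show "del a (del b xs) ! i = del (b - 1) (del a xs) ! i"
    using assms by (auto simp: length_del nth_del insert_index_def)
qed

text \<open>The entries are \<open>f x y\<close> for \<open>x\<close> before \<open>y\<close> in the list; no skew symmetry is needed.\<close>

function pf :: "('b \<Rightarrow> 'b \<Rightarrow> 'a::comm_ring_1) \<Rightarrow> 'b list \<Rightarrow> 'a" where
  "pf f [] = 1"
| "pf f (x # xs) = (\<Sum>j<length xs. (-1) ^ j * f x (xs ! j) * pf f (del j xs))"
  by pat_completeness auto
termination
  by (relation "measure (\<lambda>(f, xs). length xs)") (auto simp: length_del)

lemma pf_map: "pf f (map g xs) = pf (\<lambda>a b. f (g a) (g b)) xs"
proof (induction "length xs" arbitrary: xs rule: less_induct)
  case less
  then show ?case
    by (cases xs) (auto simp: del_map length_del intro!: sum.cong)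
qed

text \<open>Deleting the rows and columns \<open>Suc j\<close> and 0 removes the head of the list
  and position \<open>j\<close> of its tail. Expansion along row 0 reads only entries above the
  diagonal, also in the minors.\<close>

lemma pfaffian_eq_pf:
  assumes "A \<in> carrier_mat (length xs) (length xs)"
    and "\<And>i j. i < j \<Longrightarrow> j < length xs \<Longrightarrow> A $$ (i, j) = f (xs ! i) (xs ! j)"
  shows "pfaffian A = pf f xs"
  using assms
proof (induction "length xs" arbitrary: xs A rule: less_induct)
  case less
  show ?case
  proof (cases xs)
    case Nil
    with less.prems show ?thesis by (simp add: pfaffian.simps[of A])
  next
    case (Cons x ys)
    have dim: "dim_row A = Suc (length ys)" "dim_col A = Suc (length ys)"
      using less.prems(1) Cons by auto
    have minor: "pfaffian (mat_delete (mat_delete A (Suc j) (Suc j)) 0 0) = pf f (del j ys)"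
      if j: "j < length ys" for j
    proof (rule less.hyps)
      show "length (del j ys) < length xs" using j Cons by (simp add: length_del)
      show "mat_delete (mat_delete A (Suc j) (Suc j)) 0 0
          \<in> carrier_mat (length (del j ys)) (length (del j ys))"
        using j dim by (auto simp: length_del mat_delete_def)
      fix a b assume ab: "a < b" "b < length (del j ys)"
      then have b: "b < length ys - 1" using j by (simp add: length_del)
      have "mat_delete (mat_delete A (Suc j) (Suc j)) 0 0 $$ (a, b)
          = A $$ (Suc (insert_index j a), Suc (insert_index j b))"
        using j ab b dim by (auto simp: mat_delete_def insert_index_def)
      also have "\<dots> = f (del j ys ! a) (del j ys ! b)"
        using j ab b less.prems(2)[of "Suc (insert_index j a)" "Suc (insert_index j b)"]
        by (simp add: nth_del Cons) (auto simp: insert_index_def)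
      finally show "mat_delete (mat_delete A (Suc j) (Suc j)) 0 0 $$ (a, b)
          = f (del j ys ! a) (del j ys ! b)" .
    qed
    have "pfaffian A = (\<Sum>j\<in>{Suc 0..<Suc (length ys)}.
        (-1) ^ (j + 1) * A $$ (0, j) * pfaffian (mat_delete (mat_delete A j j) 0 0))"
      by (simp add: pfaffian.simps[of A] dim)
    also have "\<dots> = (\<Sum>j<length ys. (-1) ^ (Suc j + 1) * A $$ (0, Suc j) *
        pfaffian (mat_delete (mat_delete A (Suc j) (Suc j)) 0 0))"
      by (subst sum.shift_bounds_Suc_ivl) (simp add: atLeast0LessThan)
    also have "\<dots> = pf f xs"
      using less.prems(2)[of 0] by (auto simp: minor Cons intro!: sum.cong)
    finally show ?thesis .
  qed
qed

text \<open>Both orders of deleting the entries \<open>a < b\<close> of a list are collected in one term.\<close>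

lemma sum_two_deletions:
  fixes h :: "nat \<Rightarrow> nat \<Rightarrow> 'c::comm_monoid_add"
  shows "(\<Sum>j<n. \<Sum>i<n - 1. h j i) = (\<Sum>(a, b) \<in> {(a, b). a < b \<and> b < n}. h b a + h a (b - 1))"
proof -
  have fin: "finite {(a, b). a < b \<and> b < n}"
    by (rule finite_subset[of _ "{..<n} \<times> {..<n}"]) auto
  have "(\<Sum>j<n. \<Sum>i<n - 1. h j i) = (\<Sum>(j, i) \<in> {..<n} \<times> {..<n - 1}. h j i)"
    by (simp add: sum.cartesian_product)
  also have "{..<n} \<times> {..<n - 1} = {(j, i). i < j \<and> j < n} \<union> {(j, i). j \<le> i \<and> i < n - 1}"
    by auto
  also have "(\<Sum>(j, i) \<in> \<dots>. h j i)
      = (\<Sum>(j, i) \<in> {(j, i). i < j \<and> j < n}. h j i) + (\<Sum>(j, i) \<in> {(j, i). j \<le> i \<and> i < n - 1}. h j i)"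
    by (rule sum.union_disjoint)
      (auto intro: finite_subset[of _ "{..<n} \<times> {..<n}"])
  also have "(\<Sum>(j, i) \<in> {(j, i). i < j \<and> j < n}. h j i)
      = (\<Sum>(a, b) \<in> {(a, b). a < b \<and> b < n}. h b a)"
    by (rule sum.reindex_bij_witness[where i = "\<lambda>(a, b). (b, a)" and j = "\<lambda>(j, i). (i, j)"]) auto
  also have "(\<Sum>(j, i) \<in> {(j, i). j \<le> i \<and> i < n - 1}. h j i)
      = (\<Sum>(a, b) \<in> {(a, b). a < b \<and> b < n}. h a (b - 1))"
    by (rule sum.reindex_bij_witness[where i = "\<lambda>(a, b). (a, b - 1)" and j = "\<lambda>(j, i). (j, Suc i)"])
      auto
  finally show ?thesis
    by (simp add: sum.distrib[symmetric] case_prod_unfold)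
qed

text \<open>Expand along the first row, and the minors that still end in \<open>y\<close> along
  their last column by induction. Exchanging the two deletions turns the inner sum into the
  first-row expansion of \<open>x # del i ys\<close>.\<close>

lemma pf_snoc:
  assumes "odd (length xs)"
  shows "pf f (xs @ [y]) = (\<Sum>i<length xs. (-1) ^ i * f (xs ! i) y * pf f (del i xs))"
  using assms
proof (induction "length xs" arbitrary: xs rule: less_induct)
  case less
  then obtain x ys where xs: "xs = x # ys" by (cases xs) auto
  define n where "n = length ys"
  have n: "even n" using less.prems by (simp add: xs n_def)
  have IH: "pf f (del j ys @ [y]) = (\<Sum>i<n - 1. (-1) ^ i * f (del j ys ! i) y * pf f (del i (del j ys)))"
    if "j < n" for j
  proof -
    have "odd (length (del j ys))" using that n by (cases ys) (auto simp: length_del n_def)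
    with that show ?thesis
      using less.hyps[of "del j ys"] by (simp add: length_del xs n_def)
  qed
  \<comment> \<open>Pairing \<open>x\<close> with \<open>y\<close> has the sign
    \<open>(-1) ^ n = 1\<close>; it becomes the term \<open>i = 0\<close> at the end.\<close>
  have "pf f (xs @ [y]) = (\<Sum>j<n. (-1) ^ j * f x (ys ! j) * pf f (del j ys @ [y])) + f x y * pf f ys"
    using n by (simp add: xs n_def[symmetric])
      (simp add: n_def del_append del_length_snoc nth_append)
  also have "(\<Sum>j<n. (-1) ^ j * f x (ys ! j) * pf f (del j ys @ [y]))
      = (\<Sum>j<n. \<Sum>i<n - 1. (-1) ^ j * f x (ys ! j) *
          ((-1) ^ i * f (del j ys ! i) y * pf f (del i (del j ys))))"
    by (simp add: IH sum_distrib_left)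
  also have "\<dots> = (\<Sum>i<n. \<Sum>j<n - 1. (-1) ^ Suc i * f (ys ! i) y *
          ((-1) ^ j * f x (del i ys ! j) * pf f (del j (del i ys))))"
  proof (unfold sum_two_deletions, rule sum.cong, rule refl, clarify)
    fix a b assume ab: "a < b" "b < n"
    then obtain c where c: "b = Suc c" by (cases b) auto
    have 1: "del b ys ! a = ys ! a" "del a ys ! (b - 1) = ys ! b"
      using ab by (auto simp: nth_del n_def insert_index_def c)
    have 2: "del a (del b ys) = del (b - 1) (del a ys)"
      using ab by (simp add: del_del n_def)
    \<comment> \<open>The products match crosswise; the shift from \<open>b\<close> to
      \<open>b - 1\<close> accounts for the extra \<open>Suc\<close> in the sign.\<close>
    show "(-1) ^ b * f x (ys ! b) * ((-1) ^ a * f (del b ys ! a) y * pf f (del a (del b ys))) +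
        (-1) ^ a * f x (ys ! a) * ((-1) ^ (b - 1) * f (del a ys ! (b - 1)) y * pf f (del (b - 1) (del a ys))) =
        (-1) ^ Suc b * f (ys ! b) y * ((-1) ^ a * f x (del b ys ! a) * pf f (del a (del b ys))) +
        (-1) ^ Suc a * f (ys ! a) y * ((-1) ^ (b - 1) * f x (del a ys ! (b - 1)) * pf f (del (b - 1) (del a ys)))"
      unfolding 1 2 by (simp add: c algebra_simps)
  qed
  also have "\<dots> = (\<Sum>i<n. (-1) ^ Suc i * f (ys ! i) y * pf f (x # del i ys))"
    by (rule sum.cong) (simp_all add: sum_distrib_left length_del n_def[symmetric])
  also have "\<dots> + f x y * pf f ys = (\<Sum>i<Suc n. (-1) ^ i * f (xs ! i) y * pf f (del i xs))"
    by (subst sum.lessThan_Suc_shift) (simp add: xs del_Suc_Cons, simp add: del_def)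
  finally show ?case by (simp add: xs n_def)
qed

section \<open>Bordered Pfaffians of Q-functions\<close>

lemma q_0: "q 0 = 1"
proof -
  have "fps_nth (\<Prod>i<N. q_factor i) 0 = (1 :: 'a mps)" for N
    by (induction N) (simp_all add: q_factor_nth)
  then show ?thesis by (simp add: q_def limI)
qed

text \<open>An appended part 0 thus contributes the column \<open>q\<close>, the one that borders in
  \<open>Q_skew lam [0]\<close>.\<close>

lemma Q2_0_right: "Q2 r 0 = q r"
  by (simp add: Q2_def q_0)

text \<open>The Pfaffian of \<open>M_mat xs\<close> bordered by the column with entries \<open>c (xs ! i)\<close>, for \<open>xs\<close> of odd length.\<close>

definition bordered :: "(int \<Rightarrow> 'a::comm_ring_1 mps) \<Rightarrow> int list \<Rightarrow> 'a mps" where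
  "bordered c xs = (\<Sum>i<length xs. (-1) ^ i * c (xs ! i) * pf Q2 (del i xs))"

lemma bordered_cong: "(\<And>x. x \<in> set xs \<Longrightarrow> c x = d x) \<Longrightarrow> bordered c xs = bordered d xs"
  unfolding bordered_def by (intro sum.cong) auto

lemma bordered_diff: "bordered (\<lambda>x. c x - d x) xs = bordered c xs - bordered d xs"
  by (simp add: bordered_def sum_subtractf[symmetric] algebra_simps)

lemma bordered_sum:
  "bordered (\<lambda>x. \<Sum>k\<in>K. b k * c k x) xs = (\<Sum>k\<in>K. b k * bordered (c k) xs)"
proof -
  have "bordered (\<lambda>x. \<Sum>k\<in>K. b k * c k x) xs
      = (\<Sum>i<length xs. \<Sum>k\<in>K. b k * ((-1) ^ i * c k (xs ! i) * pf Q2 (del i xs)))"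
    by (simp add: bordered_def sum_distrib_left sum_distrib_right mult_ac)
  also have "\<dots> = (\<Sum>k\<in>K. b k * bordered (c k) xs)"
    by (subst sum.swap) (simp add: bordered_def sum_distrib_left)
  finally show ?thesis .
qed

section \<open>Q-functions and one-part skew functions as list Pfaffians\<close>

lemma Q_eq_pf: "Q lam = pf Q2 (if even (length lam) then lam else lam @ [0])"
  unfolding Q_def by (auto intro!: pfaffian_eq_pf simp: M_mat_def)

lemma Q_skew_single:
  "Q_skew lam [m]
    = (bordered (\<lambda>x. q (x - m)) (if odd (length lam) then lam else lam @ [0])
        :: 'a::comm_ring_1 mps)"
proof -
  have *: "pfaffian (M_skew_mat xs [m]) = (bordered (\<lambda>x. q (x - m)) xs :: 'a mps)"
    if "odd (length xs)" for xs
  proof -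
    \<comment> \<open>\<open>None\<close> marks the border, so that one entry function covers both
      blocks of the matrix.\<close>
    define f :: "int option \<Rightarrow> int option \<Rightarrow> 'a mps" where
      "f = (\<lambda>u v. case v of None \<Rightarrow> q (the u - m) | Some b \<Rightarrow> Q2 (the u) b)"
    have "pfaffian (M_skew_mat xs [m]) = pf f (map Some xs @ [None])"
      by (rule pfaffian_eq_pf)
        (auto simp: M_skew_mat_def M_mat_def N_mat_def nth_append f_def not_less less_Suc_eq)
    also have "\<dots> = bordered (\<lambda>x. q (x - m)) xs"
      using that by (simp add: pf_snoc bordered_def del_map pf_map f_def)
    finally show ?thesis .
  qed
  show ?thesis by (auto simp: Q_skew_def *)
qed

lemma pf_Q2_snoc_0: "odd (length xs) \<Longrightarrow> pf Q2 (xs @ [0]) = bordered q xs"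
  by (simp add: pf_snoc bordered_def Q2_0_right)

text \<open>Both appended zeros give the same column \<open>q\<close>, so the terms of the double
  expansion cancel in pairs; only the entry \<open>q 0 = 1\<close> between the two zeros
  survives.\<close>

lemma pf_Q2_snoc_00:
  assumes "even (length xs)"
  shows "pf Q2 (xs @ [0, 0]) = (pf Q2 xs :: 'a::comm_ring_1 mps)"
proof -
  define n where "n = length xs"
  have IH: "pf Q2 (del j xs @ [0])
      = (\<Sum>i<n - 1. (-1) ^ i * q (del j xs ! i) * (pf Q2 (del i (del j xs)) :: 'a mps))"
    if "j < n" for j
  proof -
    have "odd (length (del j xs))" using that assms by (cases xs) (auto simp: length_del n_def)
    with that show ?thesis by (simp add: pf_snoc length_del Q2_0_right n_def)
  qed
  have "pf Q2 (xs @ [0, 0]) = (bordered q (xs @ [0]) :: 'a mps)"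
    using pf_Q2_snoc_0[of "xs @ [0]"] assms by simp
  also have "\<dots> = (\<Sum>j<n. (-1) ^ j * q (xs ! j) * pf Q2 (del j xs @ [0])) + pf Q2 xs"
    using assms by (simp add: bordered_def n_def del_append del_length_snoc nth_append q_0)
  also have "(\<Sum>j<n. (-1) ^ j * q (xs ! j) * (pf Q2 (del j xs @ [0]) :: 'a mps))
      = (\<Sum>j<n. \<Sum>i<n - 1. (-1) ^ j * q (xs ! j) *
          ((-1) ^ i * q (del j xs ! i) * pf Q2 (del i (del j xs))))"
    by (simp add: IH sum_distrib_left)
  also have "\<dots> = 0"
  proof (unfold sum_two_deletions, rule sum.neutral, clarify)
    fix a b assume ab: "a < b" "b < n"
    then obtain c where c: "b = Suc c" by (cases b) auto
    have 1: "del b xs ! a = xs ! a" "del a xs ! (b - 1) = xs ! b"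
      using ab by (auto simp: nth_del n_def insert_index_def c)
    have 2: "del a (del b xs) = del (b - 1) (del a xs)"
      using ab by (simp add: del_del n_def)
    show "(-1) ^ b * q (xs ! b) * ((-1) ^ a * q (del b xs ! a) * pf Q2 (del a (del b xs))) +
        (-1) ^ a * q (xs ! a) * ((-1) ^ (b - 1) * q (del a xs ! (b - 1)) * pf Q2 (del (b - 1) (del a xs)))
        = (0 :: 'a mps)"
      unfolding 1 2 by (simp add: c algebra_simps)
  qed
  finally show ?thesis by simp
qed

text \<open>Only the zeros contribute, and deleting any one of them leaves the same list. So the
  alternating signs are summed over equal minors.\<close>

lemma bordered_delta_0:
  assumes "0 \<notin> set xs"
  shows "bordered (\<lambda>x. if x = 0 then 1 else 0) (xs @ replicate m 0)
    = (if odd m then (-1) ^ length xs * pf Q2 (xs @ replicate (m - 1) 0) else 0)"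
proof -
  define g :: "nat \<Rightarrow> 'a mps" where
    "g i = (-1) ^ i * (if (xs @ replicate m 0) ! i = 0 then 1 else 0)
      * pf Q2 (del i (xs @ replicate m 0))" for i
  have alt: "(\<Sum>i<m. (-1) ^ i) = (if odd m then 1 else 0 :: 'a mps)"
    by (induction m) auto
  have "g i = 0" if "i < length xs" for i
  proof -
    have "xs ! i \<noteq> 0" using assms that nth_mem by metis
    with that show ?thesis by (simp add: g_def nth_append)
  qed
  moreover have "g (length xs + i) = (-1) ^ i * ((-1) ^ length xs * pf Q2 (xs @ replicate (m - 1) 0))"
    if "i < m" for i
    using that by (simp add: g_def nth_append del_append_right del_replicate power_add mult_ac)
  moreover have "(\<Sum>i<length xs + m. g i) = (\<Sum>i<length xs. g i) + (\<Sum>i<m. g (length xs + i))"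
    by (induction m) (simp_all add: add.assoc)
  ultimately have "(\<Sum>i<length xs + m. g i)
      = (\<Sum>i<m. (-1) ^ i) * ((-1) ^ length xs * pf Q2 (xs @ replicate (m - 1) 0))"
    by (simp add: sum_distrib_right)
  then show ?thesis
    by (simp add: bordered_def g_def alt)
qed

section \<open>The coefficients\<close>

lemma sum_triangle_swap:
  fixes h :: "nat \<Rightarrow> nat \<Rightarrow> 'c::comm_monoid_add"
  shows "(\<Sum>k\<in>{i..<n}. \<Sum>l\<in>{k..<n}. h k l) = (\<Sum>l\<in>{i..<n}. \<Sum>k\<in>{i..l}. h k l)"
  unfolding sum.Sigma[OF finite_atLeastLessThan ballI[OF finite_atLeastLessThan]]
    sum.Sigma[OF finite_atLeastLessThan ballI[OF finite_atLeastAtMost]]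
  by (rule sum.reindex_bij_witness[where i = "\<lambda>(l, k). (k, l)" and j = "\<lambda>(k, l). (l, k)"]) auto

text \<open>
  The recursion says that the \<open>r_coeff\<close> form a left inverse of a unitriangular matrix; they are
  also a right inverse.
\<close>

lemma r_coeff_right_inverse:
  assumes "i \<le> j"
  shows "(\<Sum>k=i..j. (-1) ^ k * q (part lam i - part lam k) * r_coeff lam k j)
    = (if i = j then (-1) ^ i else (0 :: 'a::comm_ring_1 mps))"
  using assms
proof (induction j rule: less_induct)
  case (less j)
  define U :: "nat \<Rightarrow> nat \<Rightarrow> 'a mps" where "U a b = q (part lam a - part lam b)" for a b
  show ?case
  proof (cases "i = j")
    case True
    then show ?thesis by (simp add: q_0 r_coeff.simps[of lam j j])
  next
    case False
    with less.prems have ij: "i < j" by simp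
    then have "{i..j} = insert j {i..<j}" by auto
    then have "(\<Sum>k=i..j. (-1) ^ k * U i k * r_coeff lam k j)
        = (-1) ^ j * U i j + (\<Sum>k\<in>{i..<j}. (-1) ^ k * U i k * r_coeff lam k j)"
      by (simp add: r_coeff.simps[of lam j j])
    \<comment> \<open>The recursion lowers the second index of \<open>r_coeff\<close>; after the
      swap the induction hypothesis leaves only \<open>l = i\<close>, which cancels the term
      \<open>k = j\<close>.\<close>
    also have "(\<Sum>k\<in>{i..<j}. (-1) ^ k * U i k * r_coeff lam k j)
        = (\<Sum>k\<in>{i..<j}. \<Sum>l\<in>{k..<j}.
            - ((-1) ^ (j - l) * U l j * ((-1) ^ k * U i k * r_coeff lam k l)))"
      by (rule sum.cong)
        (simp_all add: r_coeff.simps[of lam _ j] U_def sum_distrib_left sum_negf mult_ac)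
    also have "\<dots> = (\<Sum>l\<in>{i..<j}. - ((-1) ^ (j - l) * U l j *
        (\<Sum>k=i..l. (-1) ^ k * U i k * r_coeff lam k l)))"
      by (simp add: sum_triangle_swap sum_negf sum_distrib_left)
    also have "\<dots> = (\<Sum>l\<in>{i..<j}. if l = i then - ((-1) ^ j * U i j) else 0)"
    proof (rule sum.cong, rule refl)
      fix l assume l: "l \<in> {i..<j}"
      have "(\<Sum>k=i..l. (-1) ^ k * U i k * r_coeff lam k l) = (if i = l then (-1) ^ i else 0)"
        using less.IH[of l] l by (simp add: U_def)
      moreover have "(-1) ^ (j - i) * (-1) ^ i = ((-1) ^ j :: 'a mps)"
        using ij by (simp add: power_add[symmetric])
      ultimately show "- ((-1) ^ (j - l) * U l j * (\<Sum>k=i..l. (-1) ^ k * U i k * r_coeff lam k l))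
          = (if l = i then - ((-1) ^ j * U i j) else 0)"
        by (simp add: mult_ac)
    qed
    also have "(-1) ^ j * U i j + \<dots> = 0" using ij by simp
    finally show ?thesis using False by (simp add: U_def)
  qed
qed

text \<open>After inserting the definition of \<open>a_coeff\<close> and swapping the sums, the
  right inverse keeps only \<open>j = i\<close>, where the two signs \<open>(-1) ^ i\<close>
  cancel.\<close>

lemma a_coeff_column_from:
  assumes "1 \<le> i" "i \<le> num_parts lam"
  shows "(\<Sum>k=i..num_parts lam. (-1) ^ k * a_coeff lam k * q (part lam i - part lam k))
    = (- q (part lam i) :: 'a::comm_ring_1 mps)"
proof -
  define n where "n = Suc (num_parts lam)"
  have n: "{k..num_parts lam} = {k..<n}" for k by (auto simp: n_def)
  have "(\<Sum>k=i..num_parts lam. (-1) ^ k * a_coeff lam k * q (part lam i - part lam k))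
      = (\<Sum>k\<in>{i..<n}. \<Sum>j\<in>{k..<n}. - ((-1) ^ j * q (part lam j) *
          ((-1) ^ k * q (part lam i - part lam k) * (r_coeff lam k j :: 'a mps))))"
    unfolding n using assms
    by (intro sum.cong)
      (simp_all add: a_coeff_def n sum_distrib_left sum_distrib_right sum_negf mult_ac)
  also have "\<dots> = (\<Sum>j\<in>{i..<n}. - ((-1) ^ j * q (part lam j) *
      (\<Sum>k=i..j. (-1) ^ k * q (part lam i - part lam k) * r_coeff lam k j)))"
    by (simp add: sum_triangle_swap sum_negf sum_distrib_left)
  also have "\<dots> = (\<Sum>j\<in>{i..<n}. if j = i then - q (part lam i) else 0)"
    proof (rule sum.cong, rule refl)
    fix j assume "j \<in> {i..<n}"
    then show "- ((-1) ^ j * q (part lam j) *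
        (\<Sum>k=i..j. (-1) ^ k * q (part lam i - part lam k) * r_coeff lam k j))
        = (if j = i then - q (part lam i) else (0 :: 'a mps))"
      by (subst r_coeff_right_inverse) (simp_all add: mult_ac)
  qed
  also have "\<dots> = - q (part lam i)" using assms by (simp add: n_def)
  finally show ?thesis .
qed

section \<open>Trailing zeros and the column identity for all rows\<close>

lemma is_partition_decomp:
  assumes "is_partition lam"
  shows "\<exists>m. lam = filter (\<lambda>x. x \<noteq> 0) lam @ replicate m 0"
  using assms
proof (induction lam)
  case (Cons x lam)
  show ?case
  proof (cases "x = 0")
    case True
    then have "\<forall>y\<in>set lam. y = 0"
      using Cons.prems by (force simp: is_partition_def)
    then have "x # lam = filter (\<lambda>x. x \<noteq> 0) (x # lam) @ replicate (Suc (length lam)) 0"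
      using True by (simp add: replicate_length_same[symmetric] filter_empty_conv)
    then show ?thesis ..
  next
    case False
    with Cons show ?thesis by (simp add: is_partition_def)
  qed
qed simp

text \<open>
  For a repeated part, the row of its first occurrence is used: there the terms with \<open>k < i\<close> vanish.
\<close>

lemma a_coeff_column:
  assumes lam: "is_partition lam" and x: "x = 0 \<or> x \<in> set lam"
  shows "(\<Sum>k=1..num_parts lam. - ((-1) ^ k * a_coeff lam k) * q (x - part lam k))
    = (q x - (if x = 0 then 1 else 0) :: 'a::comm_ring_1 mps)"
proof -
  define P where "P = filter (\<lambda>x. x \<noteq> 0) lam"
  obtain m where dec: "lam = P @ replicate m 0"
    using is_partition_decomp[OF lam] unfolding P_def by blast
  have len: "num_parts lam = length P" by (simp add: num_parts_def P_def)
  have part_P: "part lam k = P ! (k - 1)" if "1 \<le> k" "k \<le> length P" for k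
    using that by (subst dec) (auto simp: part_def nth_append)
  have pos: "y > 0" if "y \<in> set P" for y
    using that lam by (force simp: P_def is_partition_def)
  show ?thesis
  proof (cases "x = 0")
    case True
    \<comment> \<open>The nonzero parts are positive, so the argument of \<open>q\<close> is
      negative; the right-hand side is \<open>q 0 - 1 = 0\<close>.\<close>
    have "q (x - part lam k) = (0 :: 'a mps)" if k: "k \<in> {1..num_parts lam}" for k
    proof -
      have "part lam k \<in> set P"
        using k part_P[of k] nth_mem[of "k - 1" P] by (auto simp: len)
      then show ?thesis using pos True by (simp add: q_def)
    qed
    then have "(\<Sum>k=1..num_parts lam. - ((-1) ^ k * a_coeff lam k) * q (x - part lam k)) = (0 :: 'a mps)"
      by (intro sum.neutral) simp
    then show ?thesis using True by (simp add: q_0)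
  next
    case False
    with x have "\<exists>j. j < length P \<and> P ! j = x"
      by (simp add: in_set_conv_nth[symmetric] P_def)
    then have j: "(LEAST j. j < length P \<and> P ! j = x) < length P
        \<and> P ! (LEAST j. j < length P \<and> P ! j = x) = x"
      by (rule LeastI_ex)
    define i where "i = Suc (LEAST j. j < length P \<and> P ! j = x)"
    have i: "1 \<le> i" "i \<le> length P" "part lam i = x"
      using j part_P[of i] by (auto simp: i_def)
    have "q (x - part lam k) = (0 :: 'a mps)" if k: "1 \<le> k" "k < i" for k
    proof -
      \<comment> \<open>Parts before the first occurrence differ from \<open>x\<close>, hence are
        strictly larger by sortedness, and \<open>q\<close> gets a negative argument.\<close>
      have "P ! (k - 1) \<noteq> x"
        using not_less_Least[of "k - 1" "\<lambda>j. j < length P \<and> P ! j = x"] k i(2)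
        by (auto simp: i_def)
      moreover have "sorted_wrt (\<ge>) P"
        using lam by (simp add: P_def is_partition_def sorted_wrt_filter)
      then have "P ! (k - 1) \<ge> P ! (i - 1)"
        using k i(2) by (intro sorted_wrt_nth_less[of "(\<ge>)"]) auto
      ultimately show ?thesis using part_P[of k] part_P[of i] i k by (simp add: q_def)
    qed
    then have "(\<Sum>k=1..num_parts lam. - ((-1) ^ k * a_coeff lam k) * q (x - part lam k))
        = (\<Sum>k=i..num_parts lam. - ((-1) ^ k * a_coeff lam k) * q (x - part lam k) :: 'a mps)"
      using i(1) by (intro sum.mono_neutral_right) auto
    also have "\<dots> = q x"
      using a_coeff_column_from[of i lam, where 'a = 'a] i by (simp add: len sum_negf)
    finally show ?thesis using False by simp
  qed
qed

section \<open>The two parity cases\<close>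

theorem corollary5p4:
  fixes lam :: "int list"
  assumes "is_partition lam"
  shows "(Q lam :: 'a::comm_ring_1 mps) =
    (if odd (num_parts lam)
     then - (\<Sum>k=1..num_parts lam. (-1) ^ k * a_coeff lam k * Q_skew lam [part lam k])
     else (\<Sum>k=0..num_parts lam. (-1) ^ k * a_coeff lam k * Q_skew lam [part lam k]))"
proof -
  define P where "P = filter (\<lambda>x. x \<noteq> 0) lam"
  \<comment> \<open>The list that \<open>Q_skew\<close> borders. It follows the parity of
    \<open>length lam\<close>, while the cases follow that of \<open>num_parts lam\<close>; the
    count \<open>m'\<close> of zeros in \<open>ys\<close> mediates between them.\<close>
  define ys where "ys = (if odd (length lam) then lam else lam @ [0])"
  obtain m where dec: "lam = P @ replicate m 0"
    using is_partition_decomp[OF assms] unfolding P_def by blast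
  have len: "num_parts lam = length P" by (simp add: num_parts_def P_def)
  have P0: "0 \<notin> set P" by (simp add: P_def)
  define m' where "m' = (if odd (length lam) then m else Suc m)"
  have ys: "ys = P @ replicate m' 0"
    using dec by (auto simp: ys_def m'_def replicate_append_same)
  have odd_ys: "odd (length ys)" by (simp add: ys_def)
  then have par: "odd (length P + m')" by (simp add: ys)
  have skew: "Q_skew lam [x] = bordered (\<lambda>y. q (y - x)) ys" for x
    by (simp add: Q_skew_single ys_def)
  have "- (\<Sum>k=1..num_parts lam. (-1) ^ k * a_coeff lam k * Q_skew lam [part lam k])
      = bordered (\<lambda>x. \<Sum>k=1..num_parts lam. - ((-1) ^ k * a_coeff lam k) * q (x - part lam k)) ys"
    unfolding bordered_sum skew by (simp add: sum_negf)
  also have "\<dots> = bordered (\<lambda>x. q x - (if x = 0 then 1 else 0)) ys"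
    by (rule bordered_cong, rule a_coeff_column[OF assms]) (auto simp: ys_def split: if_splits)
  also have "\<dots> = bordered q ys - bordered (\<lambda>x. if x = 0 then 1 else 0) ys"
    by (rule bordered_diff)
  finally have main: "- (\<Sum>k=1..num_parts lam. (-1) ^ k * a_coeff lam k * Q_skew lam [part lam k])
      = bordered q ys - (bordered (\<lambda>x. if x = 0 then 1 else 0) ys :: 'a mps)" .
  show ?thesis
  proof (cases "odd (num_parts lam)")
    case True
    \<comment> \<open>Since \<open>length P\<close> is odd, \<open>m'\<close> is even and the signs
      cancel.\<close>
    have "bordered (\<lambda>x. if x = 0 then 1 else 0) ys = (0 :: 'a mps)"
      using True par by (simp add: ys bordered_delta_0[OF P0] len)
    \<comment> \<open>For \<open>lam\<close> of even length, \<open>bordered q ys\<close> is the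
      Pfaffian of \<open>lam @ [0, 0]\<close>.\<close>
    moreover have "Q lam = (bordered q ys :: 'a mps)"
      using pf_Q2_snoc_00[of lam, where 'a = 'a] odd_ys
      by (simp add: pf_Q2_snoc_0[symmetric] Q_eq_pf ys_def)
    ultimately show ?thesis using main True by simp
  next
    case False
    have "odd m'" using False par by (simp add: len)
    then obtain l where l: "m' = Suc l" by (cases m') auto
    \<comment> \<open>Here \<open>length P\<close> is even, so the sign is 1; the minor is
      \<open>ys\<close> with one zero removed.\<close>
    have delta: "bordered (\<lambda>x. if x = 0 then 1 else 0) ys = (pf Q2 (P @ replicate l 0) :: 'a mps)"
      unfolding ys bordered_delta_0[OF P0] using False \<open>odd m'\<close> by (simp add: len l)
    have "Q lam = (pf Q2 (P @ replicate l 0) :: 'a mps)"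
    proof (cases "even (length lam)")
      case True
      then have "P @ replicate l 0 = lam" using l dec by (simp add: m'_def)
      then show ?thesis using True by (simp add: Q_eq_pf)
    next
      \<comment> \<open>Now \<open>Q lam\<close> is the Pfaffian of \<open>P @ replicate l 0\<close>
        with two zeros appended.\<close>
      case odd: False
      then have "lam = (P @ replicate l 0) @ [0]"
        using l dec by (simp add: m'_def replicate_append_same)
      then show ?thesis
        using odd pf_Q2_snoc_00[of "P @ replicate l 0", where 'a = 'a] by (simp add: Q_eq_pf)
    qed
    \<comment> \<open>The term \<open>k = 0\<close> is \<open>bordered q ys\<close>, by
      \<open>a_coeff lam 0 = 1\<close> and \<open>part lam 0 = 0\<close>.\<close>
    moreover have "(\<Sum>k=0..num_parts lam. (-1) ^ k * a_coeff lam k * Q_skew lam [part lam k])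
        = (bordered q ys + (\<Sum>k=1..num_parts lam. (-1) ^ k * a_coeff lam k * Q_skew lam [part lam k])
          :: 'a mps)"
      by (simp add: sum.atLeast_Suc_atMost a_coeff_def part_def skew)
    ultimately show ?thesis using main delta False by (simp add: algebra_simps)
  qed
qed

end
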